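(* Let $G$ be a chordal graph on the vertex set $\{1,\ldots,n\}$ and let $A \in \mathcal{M}_G^{+}$. Then the factor width of $A$ is no larger than $\omega(G)$. Furthermore, if $\omega(G) \in \{1,2\}$ then the factor width of $A$ is equal to $\omega(G)$.
   Context: Let $\mathbb{F} \in \{\mathbb{R},\mathbb{C}\}$ (the result is stated without specifying the field). $\mathcal{M}_n^{+}$ denotes the set of $n \times n$ positive semidefinite (real symmetric if $\mathbb{F}=\mathbb{R}$, Hermitian if $\mathbb{F}=\mathbb{C}$) matrices over $\mathbb{F}$. Graphs are simple and undirected. A graph is chordal if every cycle with four or more vertices has a chord; $\omega(G)$ is the clique number of $G$ (the number of vertices of a largest clique). For $G=(V,E)$ with $V=\{1,\ldots,n\}$, $\mathcal{M}_G^{+} = \{A \in \mathcal{M}_n^{+} : a_{i,j}=0 \text{ whenever } i \neq j \text{ and } (i,j) \notin E\}$, with no restriction on diagonal entries. The factor width of $A \in \mathcal{M}_n^{+}$ is the smallest positive integer $k$ such that $A = \sum_{j=1}^r \mathbf{v}_j\mathbf{v}_j^*$ for some $r$ and some $\mathbf{v}_1,\ldots,\mathbf{v}_r \in \mathbb{F}^n$, each with at most $k$ non-zero entries.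
   Formalization: When ω(G)=2, equality of the factor width with ω(G) is claimed only for non-diagonal A: as printed it fails, e.g. for G=K_2 and A=I_2, where ω(G)=2 but the factor width is 1. Every diagonal A in M_G^+ has factor width 1, so no true case is lost. *)

theory Defs
  imports
    "HOL-Analysis.Analysis"
    "Graph_Theory.Pair_Digraph"
    "Jordan_Normal_Form.Conjugate"
begin

text \<open>
  A simple undirected graph is a \<^locale>\<open>pair_graph\<close>: a finite, loop-free digraph whose arc relation
  is symmetric. An undirected edge is thus represented by a pair of opposite arcs, and a cycle is
  the list of arcs traversed. Cycles in the sense of \<open>pre_digraph.cycle\<close> include the closed
  walks of length two along an edge and back, but those are irrelevant at length four or more.
  The vertices of a cycle are the tails of its arcs.
\<close>

definition is_chord :: "'v pair_pre_digraph \<Rightarrow> ('v \<times> 'v) list \<Rightarrow> 'v \<times> 'v \<Rightarrow> bool" where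
  "is_chord G p e \<longleftrightarrow>
     e \<in> parcs G \<and> fst e \<in> fst ` set p \<and> snd e \<in> fst ` set p \<and>
     (fst e, snd e) \<notin> set p \<and> (snd e, fst e) \<notin> set p"

definition chordal :: "'v pair_pre_digraph \<Rightarrow> bool" where
  "chordal G \<longleftrightarrow>
     (\<forall>p. pre_digraph.cycle (with_proj G) p \<and> length p \<ge> 4 \<longrightarrow> (\<exists>e. is_chord G p e))"

definition clique :: "'v pair_pre_digraph \<Rightarrow> 'v set \<Rightarrow> bool" where
  "clique G C \<longleftrightarrow> C \<subseteq> pverts G \<and> (\<forall>u\<in>C. \<forall>v\<in>C. u \<noteq> v \<longrightarrow> (u, v) \<in> parcs G)"

definition clique_number :: "'v pair_pre_digraph \<Rightarrow> nat" where
  "clique_number G = Max {card C | C. clique G C}"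

text \<open>
  The matrix notions are stated for the class of \<^const>\<open>conjugate\<close>, so that one definition covers
  both real matrices (where \<^const>\<open>conjugate\<close> is the identity) and complex ones (where it is
  \<^const>\<open>cnj\<close>). The order on \<^typ>\<open>complex\<close> is that of \<^theory>\<open>HOL-Library.Complex_Order\<close>, in which
  \<open>0 \<le> z\<close> means that \<open>z\<close> is a non-negative real.
\<close>

definition psd :: "'a::conjugatable_ordered_field ^ 'n ^ 'n \<Rightarrow> bool" where
  "psd A \<longleftrightarrow>
     (\<forall>i j. A $ i $ j = conjugate (A $ j $ i)) \<and>
     (\<forall>x. 0 \<le> (\<Sum>i\<in>UNIV. conjugate (x $ i) * (A *v x) $ i))"

definition psd_matrices :: "'n pair_pre_digraph \<Rightarrow> ('a::conjugatable_ordered_field ^ 'n ^ 'n) set"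
  where "psd_matrices G = {A. psd A \<and> (\<forall>i j. i \<noteq> j \<and> (i, j) \<notin> parcs G \<longrightarrow> A $ i $ j = 0)}"

definition outer :: "'a::conjugatable_ordered_field ^ 'n \<Rightarrow> 'a ^ 'n ^ 'n" where
  "outer v = (\<chi> i j. v $ i * conjugate (v $ j))"

definition factor_width :: "'a::conjugatable_ordered_field ^ 'n ^ 'n \<Rightarrow> nat" where
  "factor_width A =
     (LEAST k. k \<ge> 1 \<and>
        (\<exists>r (v :: nat \<Rightarrow> 'a ^ 'n).
           A = (\<Sum>j<r. outer (v j)) \<and> (\<forall>j<r. card {i. v j $ i \<noteq> 0} \<le> k)))"

definition diagonal :: "'a::zero ^ 'n ^ 'n \<Rightarrow> bool" where
  "diagonal A \<longleftrightarrow> (\<forall>i j. i \<noteq> j \<longrightarrow> A $ i $ j = 0)"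

text \<open>
  Since the edges of \<open>G\<close> only allow, and do not force, non-zero entries, \<^const>\<open>psd_matrices\<close> contains
  the identity matrix for every \<open>G\<close>, and this has factor width 1 whatever the clique number of \<open>G\<close>.
  Equality of the factor width with a clique number of 2 can therefore only be asserted of
  matrices that are not diagonal.
\<close>

lemma mat_1_in_psd_matrices:
  "(mat 1 :: 'a::conjugatable_ordered_field ^ 'n ^ 'n) \<in> psd_matrices G"
proof -
  have one: "conjugate (1::'a) = 1"
    by (metis conjugate_dist_mul conjugate_id mult.comm_neutral mult.commute)
  have "0 \<le> (\<Sum>i\<in>UNIV. conjugate (x $ i) * x $ i)" for x :: "'a ^ 'n"
    by (intro sum_nonneg) (metis conjugate_square_positive mult.commute)
  then show ?thesis
    by (auto simp: psd_matrices_def psd_def mat_def one matrix_vector_mul_lid[unfolded mat_def])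
qed

lemma factor_width_mat_1:
  "factor_width (mat 1 :: 'a::conjugatable_ordered_field ^ 'n ^ 'n) = 1"
proof -
  have one: "conjugate (1::'a) = 1"
    by (metis conjugate_dist_mul conjugate_id mult.comm_neutral mult.commute)
  obtain f :: "nat \<Rightarrow> 'n" where f: "bij_betw f {..<CARD('n)} UNIV"
    using ex_bij_betw_nat_finite[of "UNIV :: 'n set"] by (auto simp: atLeast0LessThan)
  define v :: "nat \<Rightarrow> 'a ^ 'n" where "v j = axis (f j) 1" for j
  have "(\<Sum>j<CARD('n). outer (v j)) = (\<Sum>i\<in>UNIV. outer (axis i (1::'a)))"
    unfolding v_def by (rule sum.reindex_bij_betw[OF f])
  also have "\<dots> = mat 1"
  proof -
    have "(\<Sum>k\<in>UNIV. outer (axis k (1::'a))) $ i $ j = (mat 1 :: 'a ^ 'n ^ 'n) $ i $ j" for i j :: 'n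
    proof -
      have "(\<Sum>k\<in>UNIV. outer (axis k (1::'a))) $ i $ j =
            (\<Sum>k\<in>UNIV. if k = i then (if i = j then 1 else 0) else (0::'a))"
        unfolding sum_component
        by (intro sum.cong) (auto simp: outer_def axis_def one)
      then show ?thesis by (simp add: mat_def)
    qed
    then show ?thesis by (simp add: vec_eq_iff)
  qed
  finally have "mat 1 = (\<Sum>j<CARD('n). outer (v j))" ..
  moreover have "card {i. v j $ i \<noteq> 0} \<le> 1" for j
    by (simp add: v_def axis_def)
  ultimately show ?thesis
    unfolding factor_width_def by (intro Least_equality) blast+
qed

end

theory Submission
  imports Defs "Graph_Theory.Vertex_Walk"
begin

text \<open>
  The bound comes from symmetric Gaussian elimination carried out in a perfect elimination ordering.
  A chordal graph has a simplicial vertex \<open>k\<close>, one whose neighbours form a clique, and so does each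
  of its induced subgraphs (\<open>chordal_ex_simplicial\<close>). Let \<open>A\<close> be positive semidefinite with
  the zero pattern of the graph. If the \<open>(k, k)\<close> entry vanishes, so do row and column \<open>k\<close>
  (\<open>psd_zero_diagonal_imp_zero_row\<close>). Otherwise, subtracting the rank one matrix \<open>w w\<^sup>*\<close>, where \<open>w\<close> is
  column \<open>k\<close> divided by a square root of the \<open>(k, k)\<close> entry, clears row and column \<open>k\<close> and leaves
  a Schur complement, which is again positive semidefinite (\<open>psd_schur_complement\<close>). The support of \<open>w\<close>
  consists of \<open>k\<close> and neighbours of \<open>k\<close>. As this is a clique, \<open>w\<close> has at most \<open>\<omega>(G)\<close> non-zero entries,
  and all new non-zero entries lie on edges of the graph. Hence the step can be repeated on the
  remaining vertices (\<open>psd_clique_decomposition\<close>).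

  For equality, a factor width is at least 1, which settles \<open>\<omega>(G) = 1\<close>; and a matrix of factor
  width 1 is a sum of diagonal matrices, so a non-diagonal one has factor width at least 2.
\<close>

section \<open>Simplicial vertices of chordal graphs\<close>

lemma arcs_of_vertex_list:
  assumes "ws \<noteq> []"
  shows cas_vwalk_arcs:
      "pre_digraph.cas (with_proj G) (hd ws) (vwalk_arcs ws) (last ws)"
    and awalk_verts_vwalk_arcs:
      "pre_digraph.awalk_verts (with_proj G) (hd ws) (vwalk_arcs ws) = ws"
    and tails_vwalk_arcs: "fst ` set (vwalk_arcs ws) = set (butlast ws)"
  using assms
  by (induction ws rule: vwalk_arcs.induct)
     (auto simp: pre_digraph.cas.simps pre_digraph.awalk_verts.simps)

lemma cycle_vwalk_arcs:
  assumes "v \<in> pverts G" "distinct (v # xs)"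
    and "set (vwalk_arcs (v # xs @ [v])) \<subseteq> parcs G"
  shows "pre_digraph.cycle (with_proj G) (vwalk_arcs (v # xs @ [v]))"
proof -
  let ?ws = "v # xs @ [v]"
  have "pre_digraph.awalk (with_proj G) v (vwalk_arcs ?ws) v"
    using assms(1,3) cas_vwalk_arcs[of ?ws G] by (simp add: pre_digraph.awalk_def)
  moreover have "distinct (tl (pre_digraph.awalk_verts (with_proj G) v (vwalk_arcs ?ws)))"
    using assms(2) awalk_verts_vwalk_arcs[of ?ws G] by simp
  ultimately show ?thesis
    by (auto simp: pre_digraph.cycle_def)
qed

lemma vertex_list_of_rtrancl:
  assumes "(x, y) \<in> (E \<inter> K \<times> K)\<^sup>*" "x \<in> K"
  shows "\<exists>xs. xs \<noteq> [] \<and> hd xs = x \<and> last xs = y \<and> set xs \<subseteq> K \<and> set (vwalk_arcs xs) \<subseteq> E"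
  using assms(1)
proof (induction rule: rtrancl_induct)
  case base
  show ?case using assms(2) by (intro exI[of _ "[x]"]) auto
next
  case (step y z)
  then obtain xs where "xs \<noteq> []" "hd xs = x" "last xs = y" "set xs \<subseteq> K" "set (vwalk_arcs xs) \<subseteq> E"
    by blast
  with step.hyps(2) show ?case
    by (intro exI[of _ "xs @ [z]"]) (auto simp: set_vwalk_arcs_snoc)
qed

text \<open>
  A walk of minimal length inside \<open>K\<close> is an induced path: a repeated vertex, or an edge between two
  vertices that are not consecutive, would give a shortcut.
\<close>

lemma induced_path_of_rtrancl:
  assumes "(x, y) \<in> (E \<inter> K \<times> K)\<^sup>*" "x \<in> K" "irrefl E"
  obtains xs where "xs \<noteq> []" "hd xs = x" "last xs = y" "set xs \<subseteq> K" "set (vwalk_arcs xs) \<subseteq> E"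
    "distinct xs"
    "\<And>a b. a \<in> set xs \<Longrightarrow> b \<in> set xs \<Longrightarrow> (a, b) \<in> E \<Longrightarrow> (b, a) \<in> E \<Longrightarrow>
       (a, b) \<in> set (vwalk_arcs xs) \<or> (b, a) \<in> set (vwalk_arcs xs)"
proof -
  let ?walk = "\<lambda>xs. xs \<noteq> [] \<and> hd xs = x \<and> last xs = y \<and> set xs \<subseteq> K \<and> set (vwalk_arcs xs) \<subseteq> E"
  have "\<exists>xs. ?walk xs" by (rule vertex_list_of_rtrancl[OF assms(1,2)])
  then have "\<exists>xs. ?walk xs \<and> (\<forall>zs. ?walk zs \<longrightarrow> length xs \<le> length zs)"
    by (elim exE) (rule ex_has_least_nat)
  then obtain xs where xs: "?walk xs" and min: "\<And>zs. ?walk zs \<Longrightarrow> length xs \<le> length zs"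
    by (elim exE conjE) metis
  have arcs_append: "set (vwalk_arcs (ps @ a # rs)) =
      set (vwalk_arcs (ps @ [a])) \<union> set (vwalk_arcs (a # rs))" for ps rs and a :: 'a
    by (cases "ps = []"; cases "rs = []") (auto simp: vwalk_arcs_append)
  have dist: "distinct xs"
  proof (rule ccontr)
    assume "\<not> distinct xs"
    then obtain ps a qs rs where eq: "xs = ps @ [a] @ qs @ [a] @ rs"
      using not_distinct_decomp by blast
    have "set (vwalk_arcs (a # rs)) \<subseteq> set (vwalk_arcs (a # qs @ a # rs))"
      using set_vwalk_arcs_append2[of "a # rs" "a # qs"] by simp
    then have "set (vwalk_arcs (ps @ a # rs)) \<subseteq> set (vwalk_arcs xs)"
      unfolding eq using arcs_append[of ps a rs] arcs_append[of ps a "qs @ a # rs"]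
      by (simp del: vwalk_arcs_Cons) blast
    moreover have "hd (ps @ a # rs) = x" using xs eq by (cases ps) auto
    ultimately have "?walk (ps @ a # rs)" using xs eq by (auto split: if_splits)
    from min[OF this] show False unfolding eq by simp
  qed
  have consecutive: "(a, b) \<in> set (vwalk_arcs xs)"
    if eq: "xs = ps @ a # qs @ b # rs" and ab: "(a, b) \<in> E" for ps a qs b rs
  proof -
    have "set (vwalk_arcs (b # rs)) \<subseteq> set (vwalk_arcs (a # qs @ b # rs))"
      using set_vwalk_arcs_append2[of "b # rs" "a # qs"] by simp
    then have "set (vwalk_arcs (ps @ a # b # rs)) \<subseteq> insert (a, b) (set (vwalk_arcs xs))"
      unfolding eq using arcs_append[of ps a "b # rs"] arcs_append[of ps a "qs @ b # rs"]
        vwalk_arcs_Cons[of "b # rs" a]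
      by (simp del: vwalk_arcs_Cons) blast
    moreover have "hd (ps @ a # b # rs) = x" using xs eq by (cases ps) auto
    ultimately have "?walk (ps @ a # b # rs)" using xs eq ab by (auto split: if_splits)
    from min[OF this] have "qs = []" unfolding eq by simp
    then show ?thesis
      unfolding eq using arcs_append[of ps a "b # rs"] by simp
  qed
  show ?thesis
  proof (rule that)
    fix a b assume ab: "a \<in> set xs" "b \<in> set xs" "(a, b) \<in> E" "(b, a) \<in> E"
    then have "a \<noteq> b" using assms(3) by (auto simp: irrefl_def)
    obtain ps rs where eq: "xs = ps @ a # rs" using split_list[OF ab(1)] by blast
    with ab(2) \<open>a \<noteq> b\<close> consider "b \<in> set ps" | "b \<in> set rs" by auto
    then show "(a, b) \<in> set (vwalk_arcs xs) \<or> (b, a) \<in> set (vwalk_arcs xs)"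
    proof cases
      case 1
      then obtain ps1 ps2 where "ps = ps1 @ b # ps2" by (meson split_list)
      then show ?thesis using consecutive[of ps1 b ps2 a rs] eq ab(4) by simp
    next
      case 2
      then obtain rs1 rs2 where "rs = rs1 @ b # rs2" by (meson split_list)
      then show ?thesis using consecutive[of ps a rs1 b rs2] eq ab(3) by simp
    qed
  qed (use xs dist in auto)
qed

lemma pair_graph_sym_irrefl:
  assumes "pair_graph G"
  shows "sym (parcs G)" "irrefl (parcs G)"
proof -
  interpret pair_graph G by fact
  show "sym (parcs G)" using arcs_symmetric by (auto intro: symI)
  show "irrefl (parcs G)" using no_loops' by (auto simp: irrefl_def)
qed

text \<open>
  If \<open>x\<close> and \<open>y\<close> were not adjacent, a shortest path from \<open>x\<close> to \<open>y\<close> with interior in \<open>C\<close>, closed up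
  through \<open>v\<close>, would be a cycle of length at least four. A chord of it could not end in \<open>v\<close>, whose
  only neighbours on the cycle are \<open>x\<close> and \<open>y\<close>, and could not join two vertices of a shortest path.
\<close>

lemma chordal_common_boundary_adjacent:
  assumes G: "pair_graph G" "chordal G"
    and C: "\<And>a b. a \<in> C \<Longrightarrow> b \<in> C \<Longrightarrow> (a, b) \<in> (parcs G \<inter> C \<times> C)\<^sup>*"
    and v: "v \<in> pverts G" "v \<notin> C" "\<And>c. c \<in> C \<Longrightarrow> (v, c) \<notin> parcs G"
    and vxy: "(v, x) \<in> parcs G" "(v, y) \<in> parcs G"
    and xyC: "c \<in> C" "(x, c) \<in> parcs G" "d \<in> C" "(y, d) \<in> parcs G"
    and "x \<noteq> y"
  shows "(x, y) \<in> parcs G"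
proof (rule ccontr)
  assume xy: "(x, y) \<notin> parcs G"
  note symE = symD[OF pair_graph_sym_irrefl(1)[OF G(1)]]
  have irr: "(a, a) \<notin> parcs G" for a
    using pair_graph_sym_irrefl(2)[OF G(1)] by (auto simp: irrefl_def)
  let ?K = "insert x (insert y C)"
  have "(c, d) \<in> (parcs G \<inter> ?K \<times> ?K)\<^sup>*"
    using C[OF xyC(1,3)] by (rule rtrancl_mono[THEN subsetD, rotated]) auto
  moreover have "(x, c) \<in> parcs G \<inter> ?K \<times> ?K" "(d, y) \<in> parcs G \<inter> ?K \<times> ?K"
    using xyC symE by auto
  ultimately have "(x, y) \<in> (parcs G \<inter> ?K \<times> ?K)\<^sup>*"
    by (meson converse_rtrancl_into_rtrancl rtrancl.rtrancl_into_rtrancl)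
  then obtain xs where xs: "xs \<noteq> []" "hd xs = x" "last xs = y" "set xs \<subseteq> ?K"
      "set (vwalk_arcs xs) \<subseteq> parcs G" "distinct xs"
    and chordless: "\<And>a b. a \<in> set xs \<Longrightarrow> b \<in> set xs \<Longrightarrow> (a, b) \<in> parcs G \<Longrightarrow> (b, a) \<in> parcs G \<Longrightarrow>
       (a, b) \<in> set (vwalk_arcs xs) \<or> (b, a) \<in> set (vwalk_arcs xs)"
    using induced_path_of_rtrancl[OF _ _ pair_graph_sym_irrefl(2)[OF G(1)]]
    by (metis insertI1)
  let ?p = "vwalk_arcs (v # xs @ [v])"
  have p: "set ?p = {(v, x), (y, v)} \<union> set (vwalk_arcs xs)"
    using xs(1-3) by (auto simp: set_vwalk_arcs_snoc)
  have "v \<notin> set xs" using xs(4) v(2) vxy irr by auto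
  then have "pre_digraph.cycle (with_proj G) ?p"
    using xs(5,6) v(1) vxy symE p by (intro cycle_vwalk_arcs) auto
  moreover have "length ?p \<ge> 4"
  proof -
    have "length xs \<ge> 3"
    proof (rule ccontr)
      assume "\<not> 3 \<le> length xs"
      moreover have "length xs \<noteq> 0" using xs(1) by simp
      ultimately consider "length xs = 1" | "length xs = 2" by linarith
      then show False
      proof cases
        case 1
        then show False using xs(2,3) \<open>x \<noteq> y\<close> by (auto simp: length_Suc_conv)
      next
        case 2
        then show False using xs(2,3,5) xy by (auto simp: numeral_2_eq_2 length_Suc_conv)
      qed
    qed
    then show ?thesis by (simp only: vwalk_length_simp[unfolded vwalk_length_def]) simp
  qed
  ultimately obtain a b where ab: "is_chord G ?p (a, b)"
    using G(2) unfolding chordal_def by fastforce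
  have tails: "fst ` set ?p = insert v (set xs)"
    using tails_vwalk_arcs[of "v # xs @ [v]"] xs(1) by (simp add: butlast_append)
  have ab': "(a, b) \<in> parcs G" "(b, a) \<in> parcs G" "a \<in> insert v (set xs)" "b \<in> insert v (set xs)"
    "(a, b) \<notin> set ?p" "(b, a) \<notin> set ?p"
    using ab symE unfolding is_chord_def tails by auto
  have v_nbr: "z = x \<or> z = y" if "z \<in> set xs" "(v, z) \<in> parcs G" for z
    using that xs(4) v(3) by auto
  show False
    using ab' chordless[of a b] v_nbr[of a] v_nbr[of b] irr unfolding p by auto
qed

definition simplicial_in :: "'v pair_pre_digraph \<Rightarrow> 'v set \<Rightarrow> 'v \<Rightarrow> bool" where
  "simplicial_in G W u \<longleftrightarrow> u \<in> W \<and> clique G {w \<in> W. w = u \<or> (u, w) \<in> parcs G}"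

text \<open>
  The second claim is a strengthening that makes the induction work; it implies the first
  claim unless \<open>W\<close> is a clique, and then every vertex is simplicial. Let \<open>C\<close> be the connected component
  of \<open>w\<close> in the set of non-neighbours of \<open>v\<close> in \<open>W\<close>, and \<open>S\<close> the set of vertices of \<open>W\<close>
  outside \<open>C\<close> that have a neighbour in \<open>C\<close>. All of \<open>S\<close> is adjacent to \<open>v\<close>, so \<open>S\<close> is a clique. Since
  the neighbours of a vertex of \<open>C\<close> all lie in \<open>C \<union> S\<close>, it suffices to find a vertex of \<open>C\<close> that is
  simplicial in \<open>C \<union> S\<close>. If some \<open>s \<in> S\<close> has a non-neighbour in \<open>C \<union> S\<close>, the induction hypothesis for
  \<open>C \<union> S\<close> and \<open>s\<close> gives one; otherwise \<open>S\<close> is joined to all of \<open>C\<close>, and a vertex simplicial in \<open>C\<close>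
  is simplicial in \<open>C \<union> S\<close>.
\<close>

lemma chordal_simplicial:
  assumes G: "pair_graph G" "chordal G" and W: "W \<subseteq> pverts G"
  shows chordal_ex_simplicial: "W \<noteq> {} \<Longrightarrow> \<exists>u. simplicial_in G W u"
    and chordal_ex_simplicial_nonadjacent:
      "v \<in> W \<Longrightarrow> w \<in> W \<Longrightarrow> w \<noteq> v \<Longrightarrow> (v, w) \<notin> parcs G \<Longrightarrow>
         \<exists>u. simplicial_in G W u \<and> u \<noteq> v \<and> (v, u) \<notin> parcs G"
proof -
  note symE = symD[OF pair_graph_sym_irrefl(1)[OF G(1)]]
  have "finite (pverts G)"
    using G(1) by (simp add: pair_graph_def pair_digraph_def pair_fin_digraph_def
      pair_fin_digraph_axioms_def)
  then have "finite W" using W finite_subset by blast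
  then have "(W \<noteq> {} \<longrightarrow> (\<exists>u. simplicial_in G W u)) \<and>
      (\<forall>v w. v \<in> W \<longrightarrow> w \<in> W \<longrightarrow> w \<noteq> v \<longrightarrow> (v, w) \<notin> parcs G \<longrightarrow>
        (\<exists>u. simplicial_in G W u \<and> u \<noteq> v \<and> (v, u) \<notin> parcs G))"
    using W
  proof (induction W rule: finite_psubset_induct)
    case (psubset W)
    have nonadj: "\<exists>u. simplicial_in G W u \<and> u \<noteq> v \<and> (v, u) \<notin> parcs G"
      if vw: "v \<in> W" "w \<in> W" "w \<noteq> v" "(v, w) \<notin> parcs G" for v w
    proof -
      define R where "R = {u \<in> W. u \<noteq> v \<and> (v, u) \<notin> parcs G}"
      define C where "C = {u. (w, u) \<in> (parcs G \<inter> R \<times> R)\<^sup>*}"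
      define S where "S = {s \<in> W - C. \<exists>c\<in>C. (s, c) \<in> parcs G}"
      have wR: "w \<in> R" using vw by (simp add: R_def)
      have CR: "C \<subseteq> R"
      proof
        fix u assume "u \<in> C"
        then have "(w, u) \<in> (parcs G \<inter> R \<times> R)\<^sup>*" by (simp add: C_def)
        then show "u \<in> R" by cases (use wR in auto)
      qed
      have wC: "w \<in> C" by (simp add: C_def)
      have from_w: "(w, u) \<in> (parcs G \<inter> C \<times> C)\<^sup>*" if "u \<in> C" for u
      proof -
        from that have "(w, u) \<in> (parcs G \<inter> R \<times> R)\<^sup>*" by (simp add: C_def)
        then show ?thesis
        proof (induction rule: rtrancl_induct)
          case (step y z)
          have "y \<in> C" using step.hyps(1) by (simp add: C_def)
          moreover have "z \<in> C"
            using rtrancl.rtrancl_into_rtrancl[OF step.hyps] by (simp add: C_def)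
          ultimately have "(y, z) \<in> parcs G \<inter> C \<times> C" using step.hyps(2) by blast
          with step.IH show ?case by (rule rtrancl.rtrancl_into_rtrancl)
        qed simp
      qed
      have "sym ((parcs G \<inter> C \<times> C)\<^sup>*)"
        using symE by (intro sym_rtrancl symI) auto
      then have conn: "(a, b) \<in> (parcs G \<inter> C \<times> C)\<^sup>*" if "a \<in> C" "b \<in> C" for a b
        using from_w that by (meson symD rtrancl_trans)
      have closed: "u \<in> C" if "u \<in> R" "c \<in> C" "(u, c) \<in> parcs G" for u c
      proof -
        have "(c, u) \<in> parcs G \<inter> R \<times> R" using that CR symE by auto
        then show ?thesis using that(2) unfolding C_def
          by (auto intro: rtrancl.rtrancl_into_rtrancl)
      qed
      have vC: "v \<notin> C" "\<And>c. c \<in> C \<Longrightarrow> (v, c) \<notin> parcs G"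
        using CR by (auto simp: R_def)
      have Sv: "(v, s) \<in> parcs G" if "s \<in> S" for s
        using that closed[of s] vC by (auto simp: S_def R_def)
      have Sclique: "(s, t) \<in> parcs G" if "s \<in> S" "t \<in> S" "s \<noteq> t" for s t
      proof -
        obtain c d where "c \<in> C" "(s, c) \<in> parcs G" "d \<in> C" "(t, d) \<in> parcs G"
          using \<open>s \<in> S\<close> \<open>t \<in> S\<close> unfolding S_def by blast
        then show ?thesis
          using chordal_common_boundary_adjacent[OF G conn _ vC Sv Sv] that vw(1) psubset.prems
          by blast
      qed
      let ?U = "C \<union> S"
      have vU: "v \<notin> ?U" using vC symE by (auto simp: S_def)
      have UW: "?U \<subseteq> W" using CR by (auto simp: R_def S_def)
      have nbrs: "z \<in> ?U" if "u \<in> C" "z \<in> W" "(u, z) \<in> parcs G" for u z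
        using that symE by (auto simp: S_def)
      have lift: "simplicial_in G W u \<and> u \<noteq> v \<and> (v, u) \<notin> parcs G"
        if "u \<in> C" "simplicial_in G ?U u" for u
      proof -
        have "{w \<in> W. w = u \<or> (u, w) \<in> parcs G} = {w \<in> ?U. w = u \<or> (u, w) \<in> parcs G}"
          using nbrs[OF that(1)] that(1) UW by blast
        then show ?thesis
          using that vC UW unfolding simplicial_in_def by auto
      qed
      have "\<exists>u\<in>C. simplicial_in G ?U u"
      proof (cases "\<exists>s\<in>S. \<exists>t\<in>?U. t \<noteq> s \<and> (s, t) \<notin> parcs G")
        case True
        then obtain s t where st: "s \<in> S" "t \<in> ?U" "t \<noteq> s" "(s, t) \<notin> parcs G" by blast
        have "?U \<subset> W" using vU UW vw(1) by blast
        then obtain u where u: "simplicial_in G ?U u" "u \<noteq> s" "(s, u) \<notin> parcs G"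
          using psubset.IH[of ?U] psubset.prems st by blast
        then have "u \<in> C" using Sclique[of s u] st(1) by (auto simp: simplicial_in_def)
        with u show ?thesis by blast
      next
        case False
        then have joined: "(s, t) \<in> parcs G" if "s \<in> S" "t \<in> ?U" "t \<noteq> s" for s t
          using that by blast
        have "C \<subset> W" using vU UW vw(1) by blast
        then obtain u where u: "simplicial_in G C u"
          using psubset.IH[of C] psubset.prems wC by blast
        have adj: "(a, b) \<in> parcs G"
          if ab: "a \<in> ?U" "a = u \<or> (u, a) \<in> parcs G" "b \<in> ?U" "b = u \<or> (u, b) \<in> parcs G" "a \<noteq> b"
          for a b
        proof -
          consider "a \<in> S" | "b \<in> S" | "a \<in> C" "b \<in> C" using ab(1,3) by blast
          then show ?thesis
          proof cases
            case 1
            then show ?thesis using joined[of a b] ab(3,5) by simp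
          next
            case 2
            then show ?thesis using joined[of b a] ab(1,5) symE by simp
          next
            case 3
            then show ?thesis using u ab(2,4,5) unfolding simplicial_in_def clique_def by blast
          qed
        qed
        have "clique G {w \<in> ?U. w = u \<or> (u, w) \<in> parcs G}"
          unfolding clique_def
        proof (intro conjI ballI impI)
          show "{w \<in> ?U. w = u \<or> (u, w) \<in> parcs G} \<subseteq> pverts G" using UW psubset.prems by auto
        qed (use adj in simp)
        moreover have "u \<in> C" using u by (simp add: simplicial_in_def)
        ultimately have "simplicial_in G ?U u" by (simp add: simplicial_in_def)
        then show ?thesis using u unfolding simplicial_in_def by blast
      qed
      then show ?thesis using lift by blast
    qed
    moreover have "\<exists>u. simplicial_in G W u" if "W \<noteq> {}"
    proof (cases "clique G W")
      case True
      from that obtain u where "u \<in> W" by blast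
      with True show ?thesis by (intro exI[of _ u]) (auto simp: simplicial_in_def clique_def)
    next
      case False
      then obtain v w where "v \<in> W" "w \<in> W" "w \<noteq> v" "(v, w) \<notin> parcs G"
        using psubset.prems unfolding clique_def by blast
      then show ?thesis using nonadj by blast
    qed
    ultimately show ?case by blast
  qed
  then show "W \<noteq> {} \<Longrightarrow> \<exists>u. simplicial_in G W u"
    and "v \<in> W \<Longrightarrow> w \<in> W \<Longrightarrow> w \<noteq> v \<Longrightarrow> (v, w) \<notin> parcs G \<Longrightarrow>
         \<exists>u. simplicial_in G W u \<and> u \<noteq> v \<and> (v, u) \<notin> parcs G"
    by blast+
qed

section \<open>Schur complements of positive semidefinite matrices\<close>

lemma conjugate_divide:
  "conjugate (x / y) = conjugate x / conjugate (y :: 'a::conjugatable_ordered_field)"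
proof (cases "y = 0")
  case False
  then have "conjugate (x / y) * conjugate y = conjugate x"
    by (simp flip: conjugate_dist_mul)
  with False show ?thesis by (simp add: field_simps)
qed simp

lemma conjugate_one: "conjugate (1 :: 'a::conjugatable_ordered_field) = 1"
  by (metis conjugate_divide conjugate_zero_iff div_self zero_neq_one)

definition quad_form :: "'a::conjugatable_ordered_field ^ 'n ^ 'n \<Rightarrow> 'a ^ 'n \<Rightarrow> 'a" where
  "quad_form A x = (\<Sum>i\<in>UNIV. conjugate (x $ i) * (A *v x) $ i)"

lemma psd_quad_form:
  "psd A \<longleftrightarrow> (\<forall>i j. A $ i $ j = conjugate (A $ j $ i)) \<and> (\<forall>x. 0 \<le> quad_form A x)"
  by (simp add: psd_def quad_form_def)

lemma matrix_vector_mult_add_axis_nth: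
  fixes A :: "'a::comm_ring_1 ^ 'n ^ 'm"
  shows "(A *v (x + axis k s)) $ i = (A *v x) $ i + s * A $ i $ k"
proof -
  have "(A *v axis k s) $ i = (\<Sum>j\<in>UNIV. if j = k then s * A $ i $ k else 0)"
    unfolding matrix_vector_mult_def vec_lambda_beta
    by (intro sum.cong) (auto simp: axis_def)
  then show ?thesis by (simp add: matrix_vector_right_distrib)
qed

text \<open>
  Semidefiniteness is exploited by moving \<open>x\<close> along a single coordinate axis, to complete a square or
  to make the form negative.
\<close>

lemma quad_form_add_axis:
  fixes A :: "'a::conjugatable_ordered_field ^ 'n ^ 'n"
  assumes herm: "\<And>i j. A $ i $ j = conjugate (A $ j $ i)"
  shows "quad_form A (x + axis k s) =
    quad_form A x + s * conjugate ((A *v x) $ k) + conjugate s * (A *v x) $ k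
      + conjugate s * s * A $ k $ k"
proof -
  have col: "(\<Sum>i\<in>UNIV. conjugate (x $ i) * A $ i $ k) = conjugate ((A *v x) $ k)"
    unfolding matrix_vector_mult_def vec_lambda_beta
    by (simp add: sum_conjugate conjugate_dist_mul herm[of _ k] mult.commute)
  have "quad_form A (x + axis k s) =
      (\<Sum>i\<in>UNIV. conjugate (x $ i) * (A *v x) $ i + s * (conjugate (x $ i) * A $ i $ k)
        + (if i = k then conjugate s * (A *v x) $ k + conjugate s * s * A $ k $ k else 0))"
    unfolding quad_form_def matrix_vector_mult_add_axis_nth
    by (intro sum.cong) (auto simp: axis_def conjugate_dist_add algebra_simps)
  then show ?thesis
    by (simp add: sum.distrib quad_form_def col flip: sum_distrib_left)
qed

lemma quad_form_zero: "quad_form A 0 = 0"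
  by (simp add: quad_form_def)

lemma quad_form_diff: "quad_form (A - B) x = quad_form A x - quad_form B x"
  by (simp add: quad_form_def algebra_simps sum_subtractf)

lemma quad_form_outer:
  "quad_form (outer w) x =
     (\<Sum>i\<in>UNIV. conjugate (x $ i) * w $ i) * conjugate (\<Sum>i\<in>UNIV. conjugate (x $ i) * w $ i)"
proof -
  have "(outer w *v x) $ i = w $ i * conjugate (\<Sum>i\<in>UNIV. conjugate (x $ i) * w $ i)" for i
    unfolding matrix_vector_mult_def outer_def vec_lambda_beta
    by (simp add: sum_conjugate conjugate_dist_mul sum_distrib_left mult.assoc) 
       (simp add: mult.commute)
  then show ?thesis
    by (simp add: quad_form_def sum_distrib_right mult.assoc)
qed

lemma psd_diagonal_nonneg:
  assumes "psd A"
  shows "0 \<le> A $ k $ k"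
proof -
  have herm: "\<And>i j. A $ i $ j = conjugate (A $ j $ i)" using assms unfolding psd_quad_form by blast
  have "0 \<le> quad_form A (0 + axis k 1)" using assms psd_quad_form by blast
  also have "quad_form A (0 + axis k 1) = A $ k $ k"
    using quad_form_add_axis[OF herm, of 0 k 1] by (simp add: quad_form_zero conjugate_one)
  finally show ?thesis .
qed

text \<open>
  Evaluated at \<open>e\<^sub>i + s e\<^sub>k\<close>, the quadratic form has no quadratic term in \<open>s\<close>, since the \<open>(k, k)\<close>
  entry vanishes; the linear term would make it negative for a suitable \<open>s\<close> if the \<open>(k, i)\<close> entry
  did not vanish as well.
\<close>

lemma psd_zero_diagonal_imp_zero_row:
  fixes A :: "'a::conjugatable_ordered_field ^ 'n ^ 'n"
  assumes "psd A" "A $ k $ k = 0"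
  shows "A $ k $ i = 0"
proof (rule ccontr)
  assume nz: "A $ k $ i \<noteq> 0"
  have herm: "\<And>i j. A $ i $ j = conjugate (A $ j $ i)" using assms(1) unfolding psd_quad_form by blast
  let ?N = "A $ k $ i * conjugate (A $ k $ i)"
  \<comment> \<open>At \<open>s = - t A\<^sub>k\<^sub>i\<close> this choice of \<open>t\<close> gives the form the value \<open>- A\<^sub>i\<^sub>i - 2\<close>.\<close>
  define t where "t = (A $ i $ i + 1) / ?N"
  have "conjugate t = t"
    by (simp add: t_def conjugate_divide conjugate_dist_add conjugate_dist_mul conjugate_one
        mult.commute flip: herm[of i i])
  have tN: "t * ?N = A $ i $ i + 1" using nz by (simp add: t_def)
  have c: "(A *v axis i 1) $ k = A $ k $ i"
    using matrix_vector_mult_add_axis_nth[of A 0 i 1 k] by simp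
  have q: "quad_form A (axis i 1) = A $ i $ i"
    using quad_form_add_axis[OF herm, of 0 i 1] by (simp add: quad_form_zero conjugate_one)
  have "quad_form A (axis i 1 + axis k (- (t * A $ k $ i))) = A $ i $ i - t * ?N - t * ?N"
    by (simp add: quad_form_add_axis[OF herm] c q assms(2) conjugate_neg conjugate_dist_mul
        \<open>conjugate t = t\<close> algebra_simps)
  also have "\<dots> = - A $ i $ i - 2" unfolding tN by (simp add: algebra_simps)
  finally have "0 \<le> - A $ i $ i - 2" using assms(1) psd_quad_form by metis
  moreover have "0 \<le> A $ i $ i" by (rule psd_diagonal_nonneg[OF assms(1)])
  \<comment> \<open>The order is only known to be compatible with addition, so \<open>0 \<le> - 2\<close> is refuted by hand.\<close>
  ultimately have "0 + 0 \<le> (- A $ i $ i - 2) + A $ i $ i" by (rule add_mono)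
  then have "0 + 1 \<le> (- 2) + (1 :: 'a)" by (intro add_right_mono) simp
  then have le: "1 \<le> - (1 :: 'a)" by simp
  have one: "0 \<le> (1 :: 'a)" using conjugate_square_positive[of "1::'a"] by (simp add: conjugate_one)
  have "1 + 0 \<le> - 1 + (1 :: 'a)" using le one by (rule add_mono)
  with one show False by simp
qed

text \<open>
  The subtracted matrix is column \<open>k\<close> times row \<open>k\<close>, divided by the \<open>(k, k)\<close> entry.
  The value of the new quadratic form at \<open>x\<close> is the value of the old one at \<open>x + t e\<^sub>k\<close>, where \<open>t\<close>
  completes the square in the coordinate \<open>k\<close>.
\<close>

lemma psd_schur_complement:
  fixes A :: "'a::conjugatable_ordered_field ^ 'n ^ 'n"
  assumes "psd A" and b: "A $ k $ k = b * conjugate b" "b \<noteq> 0"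
  shows "psd (A - outer (\<chi> i. A $ i $ k / conjugate b))"
proof -
  have herm: "\<And>i j. A $ i $ j = conjugate (A $ j $ i)" using assms(1) unfolding psd_quad_form by blast
  let ?w = "\<chi> i. A $ i $ k / conjugate b"
  have quad: "quad_form (A - outer ?w) x = quad_form A (x + axis k (- ((A *v x) $ k / A $ k $ k)))" for x
  proof -
    let ?c = "(A *v x) $ k"
    have "(\<Sum>i\<in>UNIV. conjugate (x $ i) * A $ i $ k) = conjugate ?c"
      unfolding matrix_vector_mult_def vec_lambda_beta
      by (simp add: sum_conjugate conjugate_dist_mul herm[of _ k] mult.commute)
    then have "(\<Sum>i\<in>UNIV. conjugate (x $ i) * ?w $ i) = conjugate ?c / conjugate b"
      by (simp flip: sum_divide_distrib)
    then have "quad_form (A - outer ?w) x = quad_form A x - ?c * conjugate ?c / (b * conjugate b)"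
      by (simp add: quad_form_diff quad_form_outer conjugate_divide mult.commute)
    also have "\<dots> = quad_form A (x + axis k (- (?c / A $ k $ k)))"
      using b(2) by (simp add: quad_form_add_axis[OF herm] b(1) conjugate_neg conjugate_divide
          conjugate_dist_mul field_simps)
    finally show ?thesis .
  qed
  have "(A - outer ?w) $ i $ j = conjugate ((A - outer ?w) $ j $ i)" for i j
  proof -
    have "conjugate (x - y) = conjugate x - conjugate y" for x y :: 'a
      using conjugate_dist_add[of x "- y"] by (simp add: conjugate_neg)
    then show ?thesis
      using herm[of i j]
      by (simp add: outer_def conjugate_dist_mul conjugate_divide mult.commute)
  qed
  moreover have "0 \<le> quad_form (A - outer ?w) x" for x
    using assms(1) unfolding quad psd_quad_form by blast
  ultimately show ?thesis
    unfolding psd_quad_form by blast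
qed

section \<open>Decomposition along cliques\<close>

lemma clique_subset: "clique G D \<Longrightarrow> C \<subseteq> D \<Longrightarrow> clique G C"
  unfolding clique_def by (meson subset_iff)

text \<open>
  Induction on the set \<open>W\<close> of indices of the rows and columns that may be non-zero: subtracting the
  rank one matrix of a simplicial vertex \<open>k\<close> of \<open>W\<close> clears row and column \<open>k\<close>. The subtracted matrix
  lives on \<open>k\<close> and its neighbours in \<open>W\<close>, a clique, so no off-diagonal entry outside the edges of \<open>G\<close>
  is filled in.
\<close>

lemma psd_clique_decomposition:
  fixes A :: "'a::conjugatable_ordered_field ^ 'n::finite ^ 'n"
  assumes G: "pair_graph G" "pverts G = UNIV" "chordal G"
    and sqrt: "\<And>a :: 'a. 0 \<le> a \<Longrightarrow> \<exists>b. a = b * conjugate b"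
    and "A \<in> psd_matrices G" "\<And>i j. A $ i $ j \<noteq> 0 \<Longrightarrow> i \<in> W \<and> j \<in> W"
  shows "\<exists>vs. A = sum_list (map outer vs) \<and> (\<forall>v\<in>set vs. clique G {i. v $ i \<noteq> 0})"
  using finite[of W] assms(5,6)
proof (induction "card W" arbitrary: W A)
  case 0
  then have "A = 0" by (auto simp: vec_eq_iff)
  then show ?case by (intro exI[of _ "[]"]) simp
next
  case (Suc n)
  then obtain k where k: "simplicial_in G W k"
    using chordal_ex_simplicial[OF G(1,3), of W] G(2) by force
  then have kW: "k \<in> W" by (simp add: simplicial_in_def)
  then have card: "n = card (W - {k})" using Suc.hyps(2) by simp
  have psd: "psd A" and pattern: "\<And>i j. i \<noteq> j \<Longrightarrow> (i, j) \<notin> parcs G \<Longrightarrow> A $ i $ j = 0"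
    using Suc.prems(2) by (auto simp: psd_matrices_def)
  have herm: "\<And>i j. A $ i $ j = conjugate (A $ j $ i)" using psd unfolding psd_def by blast
  show ?case
  proof (cases "A $ k $ k = 0")
    case True
    have "A $ k $ i = 0" "A $ i $ k = 0" for i
      using psd_zero_diagonal_imp_zero_row[OF psd True] herm[of i k] by auto
    then have "i \<in> W - {k} \<and> j \<in> W - {k}" if "A $ i $ j \<noteq> 0" for i j
      using Suc.prems(3) that by auto
    then show ?thesis using Suc.hyps(1)[OF card] Suc.prems(2) by simp
  next
    case False
    obtain b where b: "A $ k $ k = b * conjugate b"
      using sqrt psd_diagonal_nonneg[OF psd] by blast
    with False have "b \<noteq> 0" by auto
    define w where "w = (\<chi> i. A $ i $ k / conjugate b)"
    define B where "B = A - outer w"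
    have w_nz: "w $ i \<noteq> 0 \<longleftrightarrow> A $ i $ k \<noteq> 0" for i using \<open>b \<noteq> 0\<close> by (simp add: w_def)
    have B: "B $ i $ j = A $ i $ j - A $ i $ k * A $ k $ j / A $ k $ k" for i j
      using herm[of k j] b
      by (simp add: B_def outer_def w_def conjugate_divide mult.commute)
    have "{i. w $ i \<noteq> 0} \<subseteq> {i \<in> W. i = k \<or> (k, i) \<in> parcs G}"
    proof
      fix i assume "i \<in> {i. w $ i \<noteq> 0}"
      then have "A $ i $ k \<noteq> 0" by (simp add: w_nz)
      moreover from this have "A $ k $ i \<noteq> 0" using herm[of i k] by auto
      ultimately show "i \<in> {i \<in> W. i = k \<or> (k, i) \<in> parcs G}"
        using Suc.prems(3) pattern[of k i] by auto
    qed
    then have clq: "clique G {i. w $ i \<noteq> 0}"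
      by (rule clique_subset[rotated]) (use k in \<open>simp add: simplicial_in_def\<close>)
    have "psd B"
      unfolding B_def w_def by (rule psd_schur_complement[OF psd b \<open>b \<noteq> 0\<close>])
    moreover have "B $ i $ j = 0" if "i \<noteq> j" "(i, j) \<notin> parcs G" for i j
    proof -
      have "w $ i = 0 \<or> w $ j = 0" using clq that by (auto simp: clique_def)
      then show ?thesis using pattern[OF that] by (auto simp: B_def outer_def)
    qed
    ultimately have "B \<in> psd_matrices G" by (simp add: psd_matrices_def)
    moreover have "i \<in> W - {k} \<and> j \<in> W - {k}" if "B $ i $ j \<noteq> 0" for i j
    proof -
      have "i \<noteq> k" "j \<noteq> k" using that False by (auto simp: B)
      moreover have "A $ i $ j \<noteq> 0 \<or> A $ i $ k \<noteq> 0 \<and> A $ k $ j \<noteq> 0" using that by (auto simp: B)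
      ultimately show ?thesis using Suc.prems(3) by blast
    qed
    ultimately obtain vs where vs: "B = sum_list (map outer vs)" "\<forall>v\<in>set vs. clique G {i. v $ i \<noteq> 0}"
      using Suc.hyps(1)[OF card, of B] finite[of "W - {k}"] by metis
    then have "A = sum_list (map outer (w # vs))" by (simp add: B_def algebra_simps)
    then show ?thesis using vs(2) clq by (intro exI[of _ "w # vs"]) simp
  qed
qed

section \<open>Factor width\<close>

lemma card_clique_le_clique_number:
  fixes G :: "'n::finite pair_pre_digraph"
  assumes "clique G C"
  shows "card C \<le> clique_number G"
  unfolding clique_number_def using assms by (intro Max_ge) auto

lemma clique_number_pos:
  fixes G :: "'n::finite pair_pre_digraph"
  assumes "pverts G = UNIV"
  shows "1 \<le> clique_number G"
  using card_clique_le_clique_number[of G "{undefined}"] assms by (simp add: clique_def)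

lemma diagonal_sum_outer:
  fixes v :: "nat \<Rightarrow> 'a::conjugatable_ordered_field ^ 'n"
  assumes "\<And>j. j < r \<Longrightarrow> card {i. v j $ i \<noteq> 0} \<le> 1"
  shows "diagonal (\<Sum>j<r. outer (v j))"
  unfolding diagonal_def
proof (intro allI impI)
  fix a c :: 'n assume "a \<noteq> c"
  have "v j $ a = 0 \<or> v j $ c = 0" if "j < r" for j
    using assms[OF that] \<open>a \<noteq> c\<close> by (auto simp: card_le_Suc0_iff_eq)
  then show "(\<Sum>j<r. outer (v j)) $ a $ c = 0"
    unfolding sum_component by (intro sum.neutral) (force simp: outer_def)
qed

text \<open>
  The assumption on square roots is what the real and the complex numbers have in common: it makes
  each rank one matrix subtracted during the elimination of the form \<open>outer w\<close>.
\<close>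

lemma factor_width_chordal:
  fixes A :: "'a::conjugatable_ordered_field ^ 'n::finite ^ 'n"
  assumes G: "pair_graph G" "pverts G = UNIV" "chordal G"
    and sqrt: "\<And>a :: 'a. 0 \<le> a \<Longrightarrow> \<exists>b. a = b * conjugate b"
    and A: "A \<in> psd_matrices G"
  shows "factor_width A \<le> clique_number G"
    and "clique_number G \<in> {1, 2} \<Longrightarrow> (clique_number G = 2 \<Longrightarrow> \<not> diagonal A) \<Longrightarrow>
      factor_width A = clique_number G"
proof -
  let ?width = "\<lambda>k. k \<ge> 1 \<and>
    (\<exists>r (v :: nat \<Rightarrow> 'a ^ 'n). A = (\<Sum>j<r. outer (v j)) \<and> (\<forall>j<r. card {i. v j $ i \<noteq> 0} \<le> k))"
  obtain vs where vs: "A = sum_list (map outer vs)" "\<forall>v\<in>set vs. clique G {i. v $ i \<noteq> 0}"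
    using psd_clique_decomposition[OF G sqrt A, of UNIV] by auto
  have "A = (\<Sum>j<length vs. outer (vs ! j))"
    unfolding vs(1) by (simp add: sum_list_sum_nth atLeast0LessThan)
  moreover have "\<forall>j<length vs. card {i. vs ! j $ i \<noteq> 0} \<le> clique_number G"
    using vs(2) card_clique_le_clique_number by (metis nth_mem)
  ultimately have width: "?width (clique_number G)"
    using clique_number_pos[OF G(2)] by blast
  show le: "factor_width A \<le> clique_number G"
    unfolding factor_width_def by (rule Least_le) (rule width)
  have fw: "?width (factor_width A)"
    unfolding factor_width_def by (rule LeastI) (rule width)
  show "factor_width A = clique_number G"
    if "clique_number G \<in> {1, 2}" "clique_number G = 2 \<Longrightarrow> \<not> diagonal A"
  proof (rule ccontr)
    assume "factor_width A \<noteq> clique_number G"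
    with le fw that(1) have "clique_number G = 2" "factor_width A = 1" by auto
    then show False using fw that(2) diagonal_sum_outer by metis
  qed
qed

theorem theorem2:
  fixes G :: "'n::finite pair_pre_digraph"
  assumes "pair_graph G" and "pverts G = UNIV" and "chordal G"
  shows
    "(\<forall>A :: real ^ 'n ^ 'n. A \<in> psd_matrices G \<longrightarrow>
        factor_width A \<le> clique_number G \<and>
        (clique_number G \<in> {1, 2} \<and> (clique_number G = 2 \<longrightarrow> \<not> diagonal A) \<longrightarrow>
          factor_width A = clique_number G)) \<and>
     (\<forall>A :: complex ^ 'n ^ 'n. A \<in> psd_matrices G \<longrightarrow>
        factor_width A \<le> clique_number G \<and>
        (clique_number G \<in> {1, 2} \<and> (clique_number G = 2 \<longrightarrow> \<not> diagonal A) \<longrightarrow>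
          factor_width A = clique_number G))"
proof -
  have real_sqrt: "\<exists>b. a = b * conjugate b" if "0 \<le> a" for a :: real
    using that by (intro exI[of _ "sqrt a"]) simp
  have complex_sqrt: "\<exists>b. a = b * conjugate b" if "0 \<le> a" for a :: complex
    using that
    by (intro exI[of _ "of_real (sqrt (Re a))"])
       (auto simp: less_eq_complex_def complex_eq_iff)
  show ?thesis
    using factor_width_chordal[OF assms real_sqrt] factor_width_chordal[OF assms complex_sqrt]
    by blast
qed

end
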